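(* Let $n,m,p\ge 1$ be integers and let $\Phi:\mathbb{R}^n\to\mathbb{R}^m$, $f:\mathbb{R}^m\to\mathbb{R}$, $c:\mathbb{R}^m\to\mathbb{R}^p$ be functions such that $\Phi$ is continuous, $f$ is differentiable with gradient $\nabla f$, and the feasible set $F:=\{x\in\mathbb{R}^n: c(\Phi(x))\le 0\}$ is nonempty, compact and ample, i.e. $F\subseteq \mathrm{cl}(\mathrm{int}(F))$. Let $\mathcal{L}:\mathbb{R}^m\times\mathbb{R}^m\to\mathbb{R}_+$ be a loss function satisfying the following property: there exists a constant $\kappa>0$ such that for all $(y_1,y_2)\in\mathbb{R}^m\times\mathbb{R}^m$, $$\mathcal{L}(y_1,y_2)<\mathcal{L}(0,y_2)\ \Longrightarrow\ \langle y_1,y_2\rangle>\kappa\|y_1\|.$$ Let $\mathrm{attack}:\mathbb{R}^n\times\mathbb{R}_+\to 2^{\mathbb{R}^n}$ be a set-valued function such that for all $(x,r)\in\mathbb{R}^n\times\mathbb{R}_+$, $\mathrm{attack}(x,r)\subseteq\mathcal{A}^+_{\mathcal{L}}(x,r,\nabla f(\Phi(x)))$, and such that $\mathrm{attack}(x,r)$ is nonempty whenever $\mathcal{A}^+_{\mathcal{L}}(x,r,\nabla f(\Phi(x)))$ is nonempty, where $\mathcal{A}^+_{\mathcal{L}}$ denotes the set of successful directional attacks defined in the context. Then for all $x\in\mathbb{R}^n$ there exists $\overline{r}(x)>0$ such that for all $r\in[0,\overline{r}(x)]$, every $d\in\mathrm{attack}(x,r)$ is an ascent direction emanating from $x$,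 i.e. $c(\Phi(x+d))\le 0$ and $f(\Phi(x+d))>f(\Phi(x))$.
   Context: The underlying problem is: maximize $f(\Phi(x))$ over $x\in\mathbb{R}^n$ subject to $c(\Phi(x))\le 0$ (componentwise inequality). $\langle\cdot,\cdot\rangle$ is the dot product on $\mathbb{R}^m$, $\|\cdot\|$ denotes a fixed norm (on $\mathbb{R}^n$, respectively on $\mathbb{R}^m$), and $\mathcal{B}^n_r$ is the closed ball of radius $r$ centred at $0$ in $\mathbb{R}^n$ for $\|\cdot\|$. Directional attacks. For $x\in\mathbb{R}^n$ define $\Phi_x:\mathbb{R}^n\to\mathbb{R}^m$ by $\Phi_x(d):=\Phi(x+d)-\Phi(x)$. For $u\in\mathbb{R}^m$, let the target be $\hat u:=u/\|u\|$ if $u\neq 0$ and $\hat u:=0$ if $u=0$. For $(x,r,u)\in\mathbb{R}^n\times\mathbb{R}_+\times\mathbb{R}^m$ consider the problem of minimizing $\mathcal{L}(\Phi_x(d),\hat u)$ over $d\in\mathcal{B}^n_r$ subject to $c(\Phi(x)+\Phi_x(d))\le 0$. A feasible attack is a feasible point $d$ of this problem, and a successful attack is a feasible attack $d$ with $\mathcal{L}(\Phi_x(d),\hat u)<\mathcal{L}(\Phi_x(0),\hat u)=\mathcal{L}(0,\hat u)$. The set of successful attacks is denoted $$\mathcal{A}^+_{\mathcal{L}}(x,r,u):=\{d\in\mathcal{B}^n_r:\ c(\Phi(x+d))\le 0,\ \mathcal{L}(\Phi_x(d),\hat u)<\mathcal{L}(0,\hat u)\}.$$ *)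

theory Defs
  imports "HOL-Analysis.Analysis"
begin

text \<open>The norms on \<open>\<real>\<^sup>n\<close> and \<open>\<real>\<^sup>m\<close> are arbitrary, hence they are passed as functions satisfying
  the norm axioms; the library constant \<^const>\<open>norm\<close> would be the Euclidean norm.\<close>

definition is_norm :: "('a::real_vector \<Rightarrow> real) \<Rightarrow> bool" where
  "is_norm N \<longleftrightarrow>
     (\<forall>x. 0 \<le> N x) \<and>
     (\<forall>x. N x = 0 \<longleftrightarrow> x = 0) \<and>
     (\<forall>a x. N (a *\<^sub>R x) = \<bar>a\<bar> * N x) \<and>
     (\<forall>x y. N (x + y) \<le> N x + N y)"

definition norm_ball :: "('a::real_vector \<Rightarrow> real) \<Rightarrow> real \<Rightarrow> 'a set" where
  "norm_ball N r = {d. N d \<le> r}"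

text \<open>The order on \<open>real ^ 'p\<close> is componentwise.\<close>

definition feasible_set ::
  "(real ^ 'n \<Rightarrow> real ^ 'm) \<Rightarrow> (real ^ 'm \<Rightarrow> real ^ 'p) \<Rightarrow> (real ^ 'n) set" where
  "feasible_set \<Phi> c = {x. c (\<Phi> x) \<le> 0}"

definition ample :: "'a::topological_space set \<Rightarrow> bool" where
  "ample S \<longleftrightarrow> S \<subseteq> closure (interior S)"

definition increment :: "('a::ab_group_add \<Rightarrow> 'b::ab_group_add) \<Rightarrow> 'a \<Rightarrow> 'a \<Rightarrow> 'b" where
  "increment \<Phi> x d = \<Phi> (x + d) - \<Phi> x"

definition target :: "('a::real_vector \<Rightarrow> real) \<Rightarrow> 'a \<Rightarrow> 'a" where
  "target N u = (if u = 0 then 0 else u /\<^sub>R N u)"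

definition successful_attacks ::
  "(real ^ 'n \<Rightarrow> real) \<Rightarrow> (real ^ 'm \<Rightarrow> real) \<Rightarrow> (real ^ 'n \<Rightarrow> real ^ 'm) \<Rightarrow> (real ^ 'm \<Rightarrow> real ^ 'p) \<Rightarrow>
   (real ^ 'm \<Rightarrow> real ^ 'm \<Rightarrow> real) \<Rightarrow> real ^ 'n \<Rightarrow> real \<Rightarrow> real ^ 'm \<Rightarrow> (real ^ 'n) set" where
  "successful_attacks Nn Nm \<Phi> c \<L> x r u =
     {d \<in> norm_ball Nn r. c (\<Phi> (x + d)) \<le> 0 \<and>
        \<L> (increment \<Phi> x d) (target Nm u) < \<L> 0 (target Nm u)}"

definition ascent_direction ::
  "(real ^ 'n \<Rightarrow> real ^ 'm) \<Rightarrow> (real ^ 'm \<Rightarrow> real) \<Rightarrow> (real ^ 'm \<Rightarrow> real ^ 'p) \<Rightarrow>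
   real ^ 'n \<Rightarrow> real ^ 'n \<Rightarrow> bool" where
  "ascent_direction \<Phi> f c x d \<longleftrightarrow> c (\<Phi> (x + d)) \<le> 0 \<and> f (\<Phi> (x + d)) > f (\<Phi> x)"

end

theory Submission
  imports Defs
begin

text \<open>The property of the loss makes the inner product of a successful increment with the gradient
  strictly larger than a fixed multiple of the length of the increment. Continuity of the map makes
  small attacks produce small increments, and for these the first-order term dominates the Taylor
  remainder. At a critical point there are no successful attacks, since the target is zero.\<close>

text \<open>The triangle inequality and homogeneity make \<open>N\<close> convex, and a convex real
  function on an open set of a finite-dimensional space is continuous.\<close>

lemma is_norm_continuous_on:
  fixes N :: "'a::euclidean_space \<Rightarrow> real"
  assumes "is_norm N"
  shows "continuous_on UNIV N"
proof -
  have "convex_on UNIV N"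
  proof (rule convex_onI)
    fix t :: real and x y :: 'a
    assume t: "0 < t" "t < 1"
    have "N ((1 - t) *\<^sub>R x + t *\<^sub>R y) \<le> N ((1 - t) *\<^sub>R x) + N (t *\<^sub>R y)"
      using assms unfolding is_norm_def by blast
    also have "\<dots> = (1 - t) * N x + t * N y"
      using assms t by (simp add: is_norm_def)
    finally show "N ((1 - t) *\<^sub>R x + t *\<^sub>R y) \<le> (1 - t) * N x + t * N y" .
  qed simp
  then show ?thesis by (intro convex_on_continuous) auto
qed

text \<open>By compactness \<open>N\<close> attains its minimum over the Euclidean unit sphere. This
  minimum is positive because \<open>N\<close> vanishes only at 0, and by homogeneity its reciprocal
  serves as \<open>C\<close>. This half of norm equivalence turns bounds in the given norms into the
  Euclidean bounds needed for limits and derivatives.\<close>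

lemma is_norm_dominates_norm:
  fixes N :: "'a::euclidean_space \<Rightarrow> real"
  assumes N: "is_norm N"
  obtains C where "C > 0" "\<And>x. norm x \<le> C * N x"
proof -
  have "continuous_on (sphere 0 1) N"
    using is_norm_continuous_on[OF N] continuous_on_subset by blast
  moreover have "sphere (0::'a) 1 \<noteq> {}" by simp
  ultimately obtain z where z: "z \<in> sphere 0 1" "\<And>x. x \<in> sphere 0 1 \<Longrightarrow> N z \<le> N x"
    using continuous_attains_inf[of "sphere (0::'a) 1" N] compact_sphere by blast
  have "z \<noteq> 0" using z(1) by auto
  with N have Nz: "N z > 0" by (metis is_norm_def order_le_less)
  have "norm x \<le> inverse (N z) * N x" for x
  proof (cases "x = 0")
    case True
    then show ?thesis using N by (simp add: is_norm_def)
  next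
    case False
    then have "N z \<le> N (inverse (norm x) *\<^sub>R x)" by (intro z(2)) simp
    also have "\<dots> = inverse (norm x) * N x" using N by (simp add: is_norm_def)
    finally show ?thesis using Nz False by (simp add: field_simps)
  qed
  with Nz show thesis by (intro that[of "inverse (N z)"]) auto
qed

text \<open>The lower half of the first-order expansion, with the remainder bounded by a prescribed
  multiple of the step length.\<close>

lemma GDERIV_lower_bound:
  assumes "GDERIV f y :> g" and "e > 0"
  obtains \<delta> where "\<delta> > 0" "\<And>h. norm h < \<delta> \<Longrightarrow> f (y + h) - f y \<ge> h \<bullet> g - e * norm h"
proof -
  have "(f has_derivative (\<lambda>h. h \<bullet> g)) (at y)"
    using assms(1) by (simp add: gderiv_def inner_commute)
  then obtain \<delta> where \<delta>: "\<delta> > 0"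
    "\<And>z. norm (z - y) < \<delta> \<Longrightarrow> norm (f z - f y - (z - y) \<bullet> g) \<le> e * norm (z - y)"
    using assms(2) unfolding has_derivative_at_alt by blast
  have "f (y + h) - f y \<ge> h \<bullet> g - e * norm h" if "norm h < \<delta>" for h
    using \<delta>(2)[of "y + h"] that by (simp add: abs_le_iff)
  with \<delta>(1) show thesis by (rule that)
qed

theorem proposition1:
  fixes Nn :: "real ^ 'n \<Rightarrow> real"
    and Nm :: "real ^ 'm \<Rightarrow> real"
    and \<Phi> :: "real ^ 'n \<Rightarrow> real ^ 'm"
    and f :: "real ^ 'm \<Rightarrow> real"
    and grad_f :: "real ^ 'm \<Rightarrow> real ^ 'm"
    and c :: "real ^ 'm \<Rightarrow> real ^ 'p"
    and \<L> :: "real ^ 'm \<Rightarrow> real ^ 'm \<Rightarrow> real"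
    and attack :: "real ^ 'n \<Rightarrow> real \<Rightarrow> (real ^ 'n) set"
  assumes "is_norm Nn" and "is_norm Nm"
    and "continuous_on UNIV \<Phi>"
    and "\<And>y. GDERIV f y :> grad_f y"
    and "feasible_set \<Phi> c \<noteq> {}"
    and "compact (feasible_set \<Phi> c)"
    and "ample (feasible_set \<Phi> c)"
    and "\<And>y1 y2. \<L> y1 y2 \<ge> 0"
    and "\<exists>\<kappa>>0. \<forall>y1 y2. \<L> y1 y2 < \<L> 0 y2 \<longrightarrow> y1 \<bullet> y2 > \<kappa> * Nm y1"
    and "\<And>x r. r \<ge> 0 \<Longrightarrow> attack x r \<subseteq> successful_attacks Nn Nm \<Phi> c \<L> x r (grad_f (\<Phi> x))"
    and "\<And>x r. r \<ge> 0 \<Longrightarrow> successful_attacks Nn Nm \<Phi> c \<L> x r (grad_f (\<Phi> x)) \<noteq> {} \<Longrightarrow> attack x r \<noteq> {}"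
  shows "\<forall>x. \<exists>rbar>0. \<forall>r\<in>{0..rbar}. \<forall>d\<in>attack x r. ascent_direction \<Phi> f c x d"
proof
  fix x
  define g where "g = grad_f (\<Phi> x)"
  obtain \<kappa> where \<kappa>: "\<kappa> > 0" "\<And>y1 y2. \<L> y1 y2 < \<L> 0 y2 \<Longrightarrow> y1 \<bullet> y2 > \<kappa> * Nm y1"
    using assms(9) by blast
  have Nm_nonneg: "Nm y \<ge> 0" for y using assms(2) by (simp add: is_norm_def)
  have attackD: "c (\<Phi> (x + d)) \<le> 0" "Nn d \<le> r"
      "increment \<Phi> x d \<bullet> target Nm g > \<kappa> * Nm (increment \<Phi> x d)"
    if "d \<in> attack x r" "r \<ge> 0" for d r
    using assms(10)[of r x] that \<kappa>(2) by (auto simp: successful_attacks_def norm_ball_def g_def)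
  show "\<exists>rbar>0. \<forall>r\<in>{0..rbar}. \<forall>d\<in>attack x r. ascent_direction \<Phi> f c x d"
  proof (cases "g = 0")
    case True
    have False if "d \<in> attack x r" "r \<ge> 0" for d r
    proof -
      have "\<kappa> * Nm (increment \<Phi> x d) < 0"
        using attackD(3)[OF that] True by (simp add: target_def)
      then show False
        using mult_nonneg_nonneg[of \<kappa> "Nm (increment \<Phi> x d)"] \<kappa>(1) Nm_nonneg
        by (simp add: not_less[symmetric])
    qed
    \<comment> \<open>All attack sets at \<open>x\<close> with nonnegative radius are empty, so the
      choice of 1 is arbitrary.\<close>
    then show ?thesis by (intro exI[of _ 1]) force
  next
    case False
    then have Ng: "Nm g > 0" using assms(2) by (metis is_norm_def order_le_less)
    obtain A where A: "A > 0" "\<And>d. norm d \<le> A * Nn d"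
      using is_norm_dominates_norm[OF assms(1)] by blast
    obtain B where B: "B > 0" "\<And>y. norm y \<le> B * Nm y"
      using is_norm_dominates_norm[OF assms(2)] by blast
    \<comment> \<open>Chosen so that \<open>e * B = Nm g * \<kappa>\<close>: the remainder
      \<open>e * norm h\<close> is then at most the lower bound that the loss property gives for the
      first-order term.\<close>
    define e where "e = Nm g * \<kappa> / B"
    have "e > 0" using Ng \<kappa>(1) B(1) by (simp add: e_def)
    then obtain \<delta> where \<delta>: "\<delta> > 0"
      "\<And>h. norm h < \<delta> \<Longrightarrow> f (\<Phi> x + h) - f (\<Phi> x) \<ge> h \<bullet> g - e * norm h"
      using GDERIV_lower_bound assms(4)[of "\<Phi> x"] unfolding g_def by metis
    obtain \<eta> where \<eta>: "\<eta> > 0" "\<And>z. dist z x < \<eta> \<Longrightarrow> dist (\<Phi> z) (\<Phi> x) < \<delta>"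
      using assms(3) \<delta>(1) unfolding continuous_on_iff by blast
    \<comment> \<open>The factor 2 yields the strict bound \<open>norm d < \<eta>\<close> that
      continuity requires, although the ball of attacks is closed.\<close>
    have "ascent_direction \<Phi> f c x d" if r: "r \<in> {0..\<eta> / (2 * A)}" and d: "d \<in> attack x r" for r d
    proof -
      define h where "h = increment \<Phi> x d"
      have att: "c (\<Phi> (x + d)) \<le> 0" "Nn d \<le> r" "h \<bullet> target Nm g > \<kappa> * Nm h"
        using attackD[OF d] r by (auto simp: h_def)
      have "norm d \<le> A * r"
        using A(2)[of d] mult_left_mono[OF att(2), of A] A(1) by linarith
      also have "A * r \<le> A * (\<eta> / (2 * A))"
        using r A(1) by (intro mult_left_mono) auto
      also have "\<dots> < \<eta>" using A(1) \<eta>(1) by simp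
      finally have "norm h < \<delta>"
        using \<eta>(2)[of "x + d"] by (simp add: dist_norm h_def increment_def)
      then have "f (\<Phi> x + h) - f (\<Phi> x) \<ge> h \<bullet> g - e * norm h" by (rule \<delta>(2))
      \<comment> \<open>Since the target is \<open>g\<close> divided by \<open>Nm g\<close>, this is
        the loss property multiplied by \<open>Nm g\<close>. Its strictness is what makes the final
        increase of \<open>f\<close> strict.\<close>
      moreover have "h \<bullet> g > Nm g * \<kappa> * Nm h"
        using att(3) Ng False by (simp add: target_def field_simps)
      moreover have "e * norm h \<le> Nm g * \<kappa> * Nm h"
        using mult_left_mono[OF B(2)[of h], of e] \<open>e > 0\<close> B(1) by (simp add: e_def)
      ultimately show ?thesis
        using att(1) by (simp add: ascent_direction_def h_def increment_def)
    qed
    then show ?thesis using A(1) \<eta>(1) by (intro exI[of _ "\<eta> / (2 * A)"]) auto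
  qed
qed

end
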